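(* Let $A$ be a local ring with maximal ideal $\mathfrak{m}$, $M$ a finitely generated $A$-module, $\mathfrak{a}$ an ideal of $A$, and $a_1,\ldots,a_r$ a sequence of elements of $\mathfrak{m}$. Suppose that $a_1,\ldots,a_r$ is an $\mathfrak{a}$-filter-regular $M$-sequence and that there exists a generating set $S$ for $\mathfrak{a}$ such that $a_1,\ldots,a_{r-1},b$ is an absolutely superficial $M$-sequence for all $b\in S$. Then $a_1,\ldots,a_r$ is an $\mathfrak{a}$-weak $M$-sequence.
   Context: Local rings are commutative and Noetherian. For a submodule $N$ of a module $L$, $a\in A$ and an ideal $\mathfrak{b}$: $N:a=\{x\in L: ax\in N\}$, $N:\mathfrak{b}=\{x\in L:\mathfrak{b}x\subseteq N\}$. For a sequence $a_1,\ldots,a_r\in\mathfrak{m}$ put $\mathfrak{q}_i=(a_1,\ldots,a_i)$, $\mathfrak{q}_0=0$, $\mathfrak{q}=\mathfrak{q}_r$. $V(\mathfrak{a})$ is the set of prime ideals of $A$ containing $\mathfrak{a}$. A sequence $a_1,\ldots,a_r$ is an $\mathfrak{a}$-filter-regular $M$-sequence if $a_i\notin\mathfrak{p}$ for all $\mathfrak{p}\in\mathrm{Ass}(M/\mathfrak{q}_{i-1}M)\setminus V(\mathfrak{a})$, $i=1,\ldots,r$. It is an $\mathfrak{a}$-weak $M$-sequence if $\mathfrak{q}_{i-1}M:a_i\subseteq\mathfrak{q}_{i-1}M:\mathfrak{a}$ for $i=1,\ldots,r$. A sequence $a_1,\ldots,a_r$ of elements of $\mathfrak{m}$ is an absolutely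 superficial $M$-sequence if for each $i=1,\ldots,r$, with $M_{i-1}:=M/\mathfrak{q}_{i-1}M$, one has $(\mathfrak{q}^{n+1}M_{i-1}:a_i)\cap\mathfrak{q}M_{i-1}=\mathfrak{q}^nM_{i-1}$ for all sufficiently large $n$ (for the sequence $a_1,\ldots,a_{r-1},b$ the ideal $\mathfrak{q}$ is $(a_1,\ldots,a_{r-1},b)$). *)

theory Defs
  imports "HOL-Algebra.Algebra"
begin

text \<open>Local rings are commutative and Noetherian by convention.\<close>

locale local_ring = cring A + noetherian_ring A + maximalideal \<mm> A
  for A (structure) and \<mm> +
  assumes maximal_unique: "maximalideal J A \<Longrightarrow> J = \<mm>"

definition gen_submodule ::
    "('a, 'm) ring_scheme \<Rightarrow> ('a, 'b, 'n) module_scheme \<Rightarrow> 'b set \<Rightarrow> 'b set"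
  where "gen_submodule A M U = \<Inter>{K. submodule K A M \<and> U \<subseteq> K}"

definition fin_gen_module :: "('a, 'm) ring_scheme \<Rightarrow> ('a, 'b, 'n) module_scheme \<Rightarrow> bool"
  where "fin_gen_module A M \<longleftrightarrow>
    module A M \<and> (\<exists>U. finite U \<and> U \<subseteq> carrier M \<and> gen_submodule A M U = carrier M)"

text \<open>The submodule \<open>I M\<close>.\<close>

definition ideal_smult ::
    "('a, 'm) ring_scheme \<Rightarrow> 'a set \<Rightarrow> ('a, 'b, 'n) module_scheme \<Rightarrow> 'b set"
  where "ideal_smult A I M = gen_submodule A M {c \<odot>\<^bsub>M\<^esub> x | c x. c \<in> I \<and> x \<in> carrier M}"

text \<open>
  The quotient \<open>M / N\<close> is built from cosets like the quotient ring. The \<open>module\<close> record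
  extends the \<open>ring\<close> record, but the locale \<open>module\<close> never refers to the fields
  \<open>mult\<close> and \<open>one\<close>, so they are left unspecified.
\<close>

definition quotient_module ::
    "('a, 'b, 'n) module_scheme \<Rightarrow> 'b set \<Rightarrow> ('a, 'b set) module"
  where "quotient_module M N =
    \<lparr>carrier = a_rcosets\<^bsub>M\<^esub> N, monoid.mult = undefined, monoid.one = undefined,
     ring.zero = N, ring.add = set_add M,
     smult = (\<lambda>c U. \<Union>x\<in>U. N +>\<^bsub>M\<^esub> (c \<odot>\<^bsub>M\<^esub> x))\<rparr>"

definition colon_elt :: "('a, 'b, 'n) module_scheme \<Rightarrow> 'b set \<Rightarrow> 'a \<Rightarrow> 'b set"
  where "colon_elt M N c = {x \<in> carrier M. c \<odot>\<^bsub>M\<^esub> x \<in> N}"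

definition colon_ideal :: "('a, 'b, 'n) module_scheme \<Rightarrow> 'b set \<Rightarrow> 'a set \<Rightarrow> 'b set"
  where "colon_ideal M N I = {x \<in> carrier M. \<forall>c\<in>I. c \<odot>\<^bsub>M\<^esub> x \<in> N}"

definition Ass :: "('a, 'm) ring_scheme \<Rightarrow> ('a, 'b, 'n) module_scheme \<Rightarrow> 'a set set"
  where "Ass A M =
    {P. primeideal P A \<and> (\<exists>x\<in>carrier M. P = {c \<in> carrier A. c \<odot>\<^bsub>M\<^esub> x = \<zero>\<^bsub>M\<^esub>})}"

definition prime_variety :: "('a, 'm) ring_scheme \<Rightarrow> 'a set \<Rightarrow> 'a set set"
  where "prime_variety A I = {P. primeideal P A \<and> I \<subseteq> P}"

text \<open>
  A sequence \<open>a\<^sub>1, \<dots>, a\<^sub>r\<close> is a list \<open>as\<close> of length \<open>r\<close>. List positions start at \<open>0\<close>,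
  so for \<open>i < r\<close> the element \<open>as ! i\<close> is \<open>a\<close> with index \<open>i + 1\<close>, and it is
  paired with the ideal generated by the \<open>i\<close> elements that precede it.
\<close>

definition seq_ideal :: "('a, 'm) ring_scheme \<Rightarrow> 'a list \<Rightarrow> nat \<Rightarrow> 'a set"
  where "seq_ideal A as i = Idl\<^bsub>A\<^esub> (set (take i as))"

definition seq_quotient ::
    "('a, 'm) ring_scheme \<Rightarrow> ('a, 'b, 'n) module_scheme \<Rightarrow> 'a list \<Rightarrow> nat \<Rightarrow> ('a, 'b set) module"
  where "seq_quotient A M as i = quotient_module M (ideal_smult A (seq_ideal A as i) M)"

definition filter_regular_seq ::
    "('a, 'm) ring_scheme \<Rightarrow> ('a, 'b, 'n) module_scheme \<Rightarrow> 'a set \<Rightarrow> 'a list \<Rightarrow> bool"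
  where "filter_regular_seq A M I as \<longleftrightarrow>
    (\<forall>i<length as. \<forall>P \<in> Ass A (seq_quotient A M as i) - prime_variety A I. as ! i \<notin> P)"

definition weak_seq ::
    "('a, 'm) ring_scheme \<Rightarrow> ('a, 'b, 'n) module_scheme \<Rightarrow> 'a set \<Rightarrow> 'a list \<Rightarrow> bool"
  where "weak_seq A M I as \<longleftrightarrow>
    (\<forall>i<length as.
       colon_elt M (ideal_smult A (seq_ideal A as i) M) (as ! i)
         \<subseteq> colon_ideal M (ideal_smult A (seq_ideal A as i) M) I)"

text \<open>Powers of ideals are taken in the monoid of ideals, so \<open>\<qq>\<^sup>0\<close> is the whole ring.\<close>

definition absolutely_superficial_seq ::
    "('a, 'm) ring_scheme \<Rightarrow> 'a set \<Rightarrow> ('a, 'b, 'n) module_scheme \<Rightarrow> 'a list \<Rightarrow> bool"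
  where "absolutely_superficial_seq A \<mm> M as \<longleftrightarrow>
    set as \<subseteq> \<mm> \<and>
    (\<forall>i<length as.
       let \<qq> = Idl\<^bsub>A\<^esub> (set as); L = seq_quotient A M as i in
       \<forall>\<^sub>F n :: nat in sequentially.
         colon_elt L (ideal_smult A (\<qq> [^]\<^bsub>ideals_set A\<^esub> (n + 1)) L) (as ! i) \<inter> ideal_smult A \<qq> L
           = ideal_smult A (\<qq> [^]\<^bsub>ideals_set A\<^esub> n) L)"

end

theory Submission
  imports Defs
begin

text \<open>
  Put \<open>L = M / \<qq>\<^sub>i\<^sub>-\<^sub>1 M\<close> and let \<open>x \<in> L\<close> with \<open>a\<^sub>i x = 0\<close>; it suffices to show \<open>b x = 0\<close> for \<open>b \<in> S\<close>.
  With \<open>\<qq> = (a\<^sub>1, \<dots>, a\<^sub>r\<^sub>-\<^sub>1, b)\<close>, superficiality at an element \<open>c\<close> of the sequence puts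
  \<open>(0 : c) \<inter> \<qq> L\<close> inside \<open>\<qq>\<^sup>n L\<close> for all large \<open>n\<close>, so this intersection vanishes by Krull's
  intersection theorem. For \<open>i < r\<close> it contains \<open>b x\<close> (take \<open>c = a\<^sub>i\<close>). For \<open>i = r\<close> filter
  regularity gives \<open>b\<^sup>n x = 0\<close> for some \<open>n\<close>, and taking \<open>c = b\<close> the exponent descends to \<open>1\<close>.

  Krull's theorem is obtained without the Artin--Rees lemma. If \<open>z \<noteq> 0\<close>, let \<open>K\<close> be a submodule that is
  maximal among those not containing \<open>z\<close>. By maximality \<open>K\<close> contains \<open>\<mm> z\<close>, and then, for
  \<open>a \<in> \<mm>\<close> and every \<open>x\<close>, also some \<open>a\<^sup>n x\<close>; so \<open>\<qq>\<^sup>n M \<subseteq> K\<close> for some \<open>n\<close>, and \<open>z \<notin> \<qq>\<^sup>n M\<close>.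
\<close>

section \<open>Ideals of Noetherian and local rings\<close>

text \<open>A nonempty chain of ideals in a Noetherian ring contains its own union, so Zorn's lemma
  applies to every predicate \<open>P\<close>, whether or not \<open>P\<close> is stable under
  unions.\<close>

lemma (in noetherian_ring) exists_maximal_ideal_above:
  assumes "ideal J R" "P J"
  obtains I where "ideal I R" "J \<subseteq> I" "P I"
    "\<And>K. ideal K R \<Longrightarrow> I \<subseteq> K \<Longrightarrow> P K \<Longrightarrow> K = I"
proof -
  let ?S = "{I. ideal I R \<and> J \<subseteq> I \<and> P I}"
  have "\<Union>C \<in> ?S" if "C \<noteq> {}" "subset.chain ?S C" for C
  proof -
    have "subset.chain {I. ideal I R} C"
      using that(2) unfolding pred_on.chain_def by blast
    then have "\<Union>C \<in> C"
      by (rule ideal_chain_is_trivial[OF that(1)])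
    then show ?thesis
      using that(2) unfolding pred_on.chain_def by blast
  qed
  then have "\<exists>I\<in>?S. \<forall>K\<in>?S. I \<subseteq> K \<longrightarrow> K = I"
    using assms by (intro subset_Zorn_nonempty) auto
  then obtain I where I: "I \<in> ?S" "\<forall>K\<in>?S. I \<subseteq> K \<longrightarrow> K = I"
    by (rule bexE)
  show ?thesis
  proof (rule that)
    fix K assume "ideal K R" "I \<subseteq> K" "P K"
    moreover from this have "K \<in> ?S"
      using I(1) by auto
    ultimately show "K = I"
      using I(2) by blast
  qed (use I(1) in auto)
qed

text \<open>A maximal member of \<open>range I\<close> is some \<open>I n\<close>, and its successor
  cannot exceed it.\<close>

lemma (in noetherian_ring) ascending_ideals_stabilise:
  fixes I :: "nat \<Rightarrow> 'a set"
  assumes "\<And>n. ideal (I n) R" "\<And>n. I n \<subseteq> I (Suc n)"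
  obtains n where "I (Suc n) = I n"
proof -
  obtain J where "J \<in> range I" "\<And>K. ideal K R \<Longrightarrow> J \<subseteq> K \<Longrightarrow> K \<in> range I \<Longrightarrow> K = J"
    by (rule exists_maximal_ideal_above[of "I 0" "\<lambda>J. J \<in> range I"]) (use assms(1) in auto)
  then obtain n where "J = I n" "\<And>k. I n \<subseteq> I k \<Longrightarrow> I k = I n"
    using assms(1) by blast
  then show ?thesis
    using that assms(2) by blast
qed

section \<open>Powers of ideals and nilpotence modulo an ideal\<close>

lemma (in cring) ideal_pow_ideal:
  assumes "ideal I R"
  shows "ideal (I [^]\<^bsub>ideals_set R\<^esub> (n::nat)) R"
proof -
  interpret ideals: comm_monoid "ideals_set R"
    by (rule ideals_set_is_comm_monoid)
  show ?thesis
    using ideals.nat_pow_closed[of I n] assms by (simp add: ideals_set_def)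
qed

lemma (in cring) ideal_pow_add:
  assumes "ideal I R"
  shows "I [^]\<^bsub>ideals_set R\<^esub> (k + n::nat) =
    (I [^]\<^bsub>ideals_set R\<^esub> k) \<cdot> (I [^]\<^bsub>ideals_set R\<^esub> n)"
proof -
  interpret ideals: comm_monoid "ideals_set R"
    by (rule ideals_set_is_comm_monoid)
  show ?thesis
    using ideals.nat_pow_mult[of I k n] assms by (simp add: ideals_set_def)
qed

lemma (in cring) ideal_pow_0:
  "I [^]\<^bsub>ideals_set R\<^esub> (0::nat) = carrier R"
  by (simp add: ideals_set_def)

lemma (in cring) ideal_pow_1:
  assumes "ideal I R"
  shows "I [^]\<^bsub>ideals_set R\<^esub> (1::nat) = I"
proof -
  interpret ideals: comm_monoid "ideals_set R"
    by (rule ideals_set_is_comm_monoid)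
  show ?thesis
    using ideals.nat_pow_eone[of I] assms by (simp add: ideals_set_def)
qed

lemma (in cring) ideal_pow_antimono:
  assumes "ideal I R" "k \<le> n"
  shows "I [^]\<^bsub>ideals_set R\<^esub> (n::nat) \<subseteq> I [^]\<^bsub>ideals_set R\<^esub> k"
proof -
  obtain l where "n = k + l"
    using assms(2) le_Suc_ex by blast
  then show ?thesis
    using ideal_prod_inter[OF ideal_pow_ideal ideal_pow_ideal, OF assms(1) assms(1), of k l]
    by (simp add: ideal_pow_add[OF assms(1)])
qed

lemma (in cring) mem_add_cgenideal:
  assumes "ideal J R" "u \<in> carrier R"
  shows "ideal (set_add R J (PIdl u)) R" "J \<subseteq> set_add R J (PIdl u)" "u \<in> set_add R J (PIdl u)"
proof -
  have P: "ideal (PIdl u) R" "u \<in> PIdl u"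
    using assms by (simp_all add: cgenideal_ideal cgenideal_self)
  show "ideal (set_add R J (PIdl u)) R"
    by (rule add_ideals[OF assms(1) P(1)])
  show "J \<subseteq> set_add R J (PIdl u)"
  proof
    fix x assume x: "x \<in> J"
    have "x = x \<oplus> \<zero>" using x assms(1) by (simp add: ideal.Icarr)
    moreover have "\<zero> \<in> PIdl u"
      using P(1) by (simp add: additive_subgroup.zero_closed ideal.axioms(1))
    ultimately show "x \<in> set_add R J (PIdl u)"
      using x unfolding set_add_def' by blast
  qed
  have "u = \<zero> \<oplus> u" using assms(2) by simp
  moreover have "\<zero> \<in> J"
    using assms(1) by (simp add: additive_subgroup.zero_closed ideal.axioms(1))
  ultimately show "u \<in> set_add R J (PIdl u)"
    using P(2) unfolding set_add_def' by blast
qed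

text \<open>In the expansion of \<open>(a \<oplus> c \<otimes> u) \<otimes> (b \<oplus> d \<otimes>
  v)\<close> every term has a factor in \<open>J\<close>, except for a multiple of
  \<open>u \<otimes> v\<close>, which lies in \<open>J\<close> by assumption.\<close>

lemma (in cring) ideal_prod_add_cgenideal:
  assumes J: "ideal J R" and uv: "u \<in> carrier R" "v \<in> carrier R" "u \<otimes> v \<in> J"
  shows "(set_add R J (PIdl u)) \<cdot> (set_add R J (PIdl v)) \<subseteq> J"
proof
  interpret J: ideal J R by (rule J)
  fix s assume "s \<in> (set_add R J (PIdl u)) \<cdot> (set_add R J (PIdl v))"
  then show "s \<in> J"
  proof (induct s rule: ideal_prod.induct)
    case (prod i j)
    obtain a c where a: "a \<in> J" "c \<in> carrier R" "i = a \<oplus> c \<otimes> u"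
      using prod(1) unfolding set_add_def' cgenideal_def by blast
    obtain b d where b: "b \<in> J" "d \<in> carrier R" "j = b \<oplus> d \<otimes> v"
      using prod(2) unfolding set_add_def' cgenideal_def by blast
    have carr: "a \<in> carrier R" "b \<in> carrier R"
      using a b J.Icarr by auto
    have "i \<otimes> j = (a \<otimes> j \<oplus> (c \<otimes> u) \<otimes> b) \<oplus> (c \<otimes> d) \<otimes> (u \<otimes> v)"
      unfolding a(3) b(3) using a(2) b(2) carr uv(1,2) by algebra
    moreover have "a \<otimes> j \<in> J" "(c \<otimes> u) \<otimes> b \<in> J" "(c \<otimes> d) \<otimes> (u \<otimes> v) \<in> J"
      using a b carr uv by (auto intro: J.I_l_closed J.I_r_closed)
    ultimately show ?case by simp
  qed simp
qed

text \<open>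
  An ideal that is maximal among those containing \<open>J\<close> and no power of \<open>I\<close> is prime, hence contains
  every element with a power in \<open>J\<close>.
\<close>

lemma (in noetherian_ring) ideal_pow_subset:
  assumes "cring R" and I: "ideal I R" and J: "ideal J R"
    and nil: "\<And>a. a \<in> I \<Longrightarrow> \<exists>n::nat. a [^] n \<in> J"
  shows "\<exists>n::nat. I [^]\<^bsub>ideals_set R\<^esub> n \<subseteq> J"
proof (rule ccontr)
  interpret cring R by (rule assms(1))
  interpret I: ideal I R by (rule I)
  let ?nopow = "\<lambda>K. \<forall>n::nat. \<not> I [^]\<^bsub>ideals_set R\<^esub> n \<subseteq> K"
  assume "\<nexists>n::nat. I [^]\<^bsub>ideals_set R\<^esub> n \<subseteq> J"
  then obtain K where K: "ideal K R" "J \<subseteq> K" "?nopow K"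
    and max: "\<And>K'. ideal K' R \<Longrightarrow> K \<subseteq> K' \<Longrightarrow> ?nopow K' \<Longrightarrow> K' = K"
    by (elim exists_maximal_ideal_above[of J ?nopow, OF J, rotated]) blast+
  \<comment> \<open>Adjoining \<open>u\<close> enlarges \<open>K\<close> strictly, so by maximality
    the larger ideal contains a power of \<open>I\<close>.\<close>
  have *: "\<exists>n::nat. I [^]\<^bsub>ideals_set R\<^esub> n \<subseteq> set_add R K (PIdl u)" if "u \<in> carrier R" "u \<notin> K" for u
    using max[of "set_add R K (PIdl u)"] mem_add_cgenideal[OF K(1) that(1)] that(2) by metis
  have prime: "u \<in> K \<or> v \<in> K" if uv: "u \<in> carrier R" "v \<in> carrier R" "u \<otimes> v \<in> K" for u v
  proof (rule ccontr)
    assume "\<not> (u \<in> K \<or> v \<in> K)"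
    then obtain k n :: nat where "I [^]\<^bsub>ideals_set R\<^esub> k \<subseteq> set_add R K (PIdl u)" "I [^]\<^bsub>ideals_set R\<^esub> n \<subseteq> set_add R K (PIdl v)"
      using * uv by meson
    moreover have "P \<cdot> Q \<subseteq> P' \<cdot> Q'" if "P \<subseteq> P'" "Q \<subseteq> Q'" for P Q P' Q'
    proof
      fix s assume "s \<in> P \<cdot> Q"
      then show "s \<in> P' \<cdot> Q'"
        by induct (use that in \<open>auto intro: ideal_prod.intros\<close>)
    qed
    ultimately have "I [^]\<^bsub>ideals_set R\<^esub> (k + n) \<subseteq> (set_add R K (PIdl u)) \<cdot> (set_add R K (PIdl v))"
      by (simp add: ideal_pow_add[OF I])
    then show False
      using ideal_prod_add_cgenideal[OF K(1) uv] K(3) by blast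
  qed
  \<comment> \<open>Otherwise \<open>K\<close> would contain the zeroth power of \<open>I\<close>,
    which is the whole ring.\<close>
  have proper: "\<one> \<notin> K"
    using K(1,3) ideal.one_imp_carrier ideal_pow_0[of I] by blast
  have "a \<in> K" if a: "a \<in> I" for a
  proof -
    obtain n :: nat where n: "a [^] n \<in> K"
      using nil[OF a] K(2) by blast
    then show ?thesis
    proof (induct n)
      case 0
      then show ?case using proper by simp
    next
      case (Suc n)
      then show ?case using prime[of "a [^] n" a] I.Icarr[OF a] by auto
    qed
  qed
  then show False
    using K(3) ideal_pow_1[OF I] by (metis subsetI)
qed

text \<open>A non-unit lies in an ideal maximal among those without \<open>\<one>\<close>. That
  ideal is maximal, hence equal to \<open>\<mm>\<close>, so \<open>\<mm>\<close> would contain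
  \<open>(\<one> \<ominus> t) \<oplus> t = \<one>\<close>.\<close>

lemma (in local_ring) one_minus_mem_Units:
  assumes "t \<in> \<mm>"
  shows "\<one> \<ominus> t \<in> Units A"
proof (rule ccontr)
  let ?u = "\<one> \<ominus> t"
  have t: "t \<in> carrier A" and u: "?u \<in> carrier A"
    using assms Icarr by auto
  assume not_unit: "?u \<notin> Units A"
  have "\<one> \<notin> PIdl ?u"
  proof
    assume "\<one> \<in> PIdl ?u"
    then obtain c where "c \<in> carrier A" "c \<otimes> ?u = \<one>"
      unfolding cgenideal_def by auto
    then show False
      using not_unit u m_comm[of c ?u] unfolding Units_def by auto
  qed
  then obtain I where I: "ideal I A" "PIdl ?u \<subseteq> I" "\<one> \<notin> I"
    and max: "\<And>J. ideal J A \<Longrightarrow> I \<subseteq> J \<Longrightarrow> \<one> \<notin> J \<Longrightarrow> J = I"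
    by (elim exists_maximal_ideal_above[of "PIdl ?u" "\<lambda>I. \<one> \<notin> I", OF cgenideal_ideal[OF u], rotated])
      blast+
  have "maximalideal I A"
  proof (rule maximalidealI[OF I(1)])
    show "carrier A \<noteq> I" using I(3) by auto
    show "J = I \<or> J = carrier A" if "ideal J A" "I \<subseteq> J" for J
      using max[OF that] ideal.one_imp_carrier[OF that(1)] by blast
  qed
  then have "?u \<in> \<mm>"
    using maximal_unique I(2) cgenideal_self[OF u] by blast
  then have "?u \<oplus> t \<in> \<mm>"
    using assms by simp
  moreover have "?u \<oplus> t = \<one>"
    using t unfolding a_minus_def by algebra
  ultimately show False
    using one_imp_carrier I_notcarr by simp
qed

section \<open>Submodules and Krull's intersection theorem\<close>

context module
begin

lemma gen_submodule_minimal: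
  assumes "submodule K R M" "U \<subseteq> K"
  shows "gen_submodule R M U \<subseteq> K"
  using assms unfolding gen_submodule_def by blast

lemma gen_submodule_incl: "U \<subseteq> gen_submodule R M U"
  unfolding gen_submodule_def by blast

lemma gen_submodule_submodule:
  assumes "U \<subseteq> carrier M"
  shows "submodule (gen_submodule R M U) R M"
proof (rule submoduleI)
  have "carrier M \<in> {K. submodule K R M \<and> U \<subseteq> K}"
    using assms carrier_is_submodule by simp
  then show "gen_submodule R M U \<subseteq> carrier M"
    unfolding gen_submodule_def by blast
qed (auto simp: gen_submodule_def submoduleE dest: submoduleE(3-5) subgroup.one_closed[OF submodule.axioms(1)])

lemma submodule_zero_closed:
  assumes "submodule K R M"
  shows "\<zero>\<^bsub>M\<^esub> \<in> K"
  using subgroup.one_closed[OF submodule.axioms(1)[OF assms]] by simp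

lemma ideal_smult_submodule:
  assumes "I \<subseteq> carrier R"
  shows "submodule (ideal_smult R I M) R M"
  unfolding ideal_smult_def by (rule gen_submodule_submodule) (use assms in auto)

lemma smult_mem_ideal_smult:
  assumes "c \<in> I" "x \<in> carrier M"
  shows "c \<odot>\<^bsub>M\<^esub> x \<in> ideal_smult R I M"
  unfolding ideal_smult_def by (rule subsetD[OF gen_submodule_incl]) (use assms in auto)

lemma zero_submodule: "submodule {\<zero>\<^bsub>M\<^esub>} R M"
  by (rule submoduleI) auto

text \<open>This conductor \<open>(K : x)\<close>, the annihilator of \<open>x\<close> when
  \<open>K\<close> is zero, carries the Noetherian property of the ring over to arguments about
  elements of \<open>M\<close>.\<close>

lemma ideal_smult_mem_submodule:
  assumes K: "submodule K R M" and x: "x \<in> carrier M"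
  shows "ideal {t \<in> carrier R. t \<odot>\<^bsub>M\<^esub> x \<in> K} R"
proof (rule idealI[OF R.ring_axioms])
  show "subgroup {t \<in> carrier R. t \<odot>\<^bsub>M\<^esub> x \<in> K} (add_monoid R)"
  proof (rule R.add.subgroupI)
    show "{t \<in> carrier R. t \<odot>\<^bsub>M\<^esub> x \<in> K} \<noteq> {}"
      using submodule_zero_closed[OF K] x by (auto intro!: exI[of _ \<zero>])
  qed (auto simp: x smult_l_minus smult_l_distr submoduleE[OF K] simp flip: a_inv_def)
next
  fix t c assume t: "t \<in> {t \<in> carrier R. t \<odot>\<^bsub>M\<^esub> x \<in> K}" and c: "c \<in> carrier R"
  then show "c \<otimes> t \<in> {t \<in> carrier R. t \<odot>\<^bsub>M\<^esub> x \<in> K}"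
    using x by (simp add: smult_assoc1 submoduleE(4)[OF K])
  then show "t \<otimes> c \<in> {t \<in> carrier R. t \<odot>\<^bsub>M\<^esub> x \<in> K}"
    using t c by (simp add: R.m_comm)
qed

text \<open>With this, a statement \<open>t \<odot> x \<in> K\<close> need only be checked on
  generators of \<open>M\<close>.\<close>

lemma submodule_preimage:
  assumes K: "submodule K R M" and t: "t \<in> carrier R"
  shows "submodule {x \<in> carrier M. t \<odot>\<^bsub>M\<^esub> x \<in> K} R M"
proof (rule submoduleI)
  fix c x assume "c \<in> carrier R" "x \<in> {x \<in> carrier M. t \<odot>\<^bsub>M\<^esub> x \<in> K}"
  moreover from this have "t \<odot>\<^bsub>M\<^esub> (c \<odot>\<^bsub>M\<^esub> x) = c \<odot>\<^bsub>M\<^esub> (t \<odot>\<^bsub>M\<^esub> x)"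
    using t by (simp flip: smult_assoc1 add: R.m_comm)
  ultimately show "c \<odot>\<^bsub>M\<^esub> x \<in> {x \<in> carrier M. t \<odot>\<^bsub>M\<^esub> x \<in> K}"
    using submoduleE(4)[OF K] by auto
qed (auto simp: t smult_r_minus smult_r_distr submoduleE(3,5)[OF K] submodule_zero_closed[OF K])

text \<open>The sum of \<open>K\<close> and the cyclic submodule of \<open>y\<close>, written by
  elements so that membership unfolds to an explicit equation.\<close>

lemma submodule_add_cyclic:
  assumes K: "submodule K R M" and y: "y \<in> carrier M"
  shows "submodule {k \<oplus>\<^bsub>M\<^esub> c \<odot>\<^bsub>M\<^esub> y | k c. k \<in> K \<and> c \<in> carrier R} R M" (is "submodule ?L R M")
proof (rule submoduleI)
  have Kc: "k \<in> carrier M" if "k \<in> K" for k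
    using submoduleE(1)[OF K] that by blast
  show "?L \<subseteq> carrier M"
    using y Kc by auto
  show "\<zero>\<^bsub>M\<^esub> \<in> ?L"
    using y submodule_zero_closed[OF K] by (auto intro!: exI[of _ "\<zero>\<^bsub>M\<^esub>"] exI[of _ \<zero>])
  fix u assume "u \<in> ?L"
  then obtain k c where u: "k \<in> K" "c \<in> carrier R" "u = k \<oplus>\<^bsub>M\<^esub> c \<odot>\<^bsub>M\<^esub> y"
    by blast
  have "\<ominus>\<^bsub>M\<^esub> u = \<ominus>\<^bsub>M\<^esub> k \<oplus>\<^bsub>M\<^esub> (\<ominus> c) \<odot>\<^bsub>M\<^esub> y"
    using u y Kc by (simp add: smult_l_minus M.minus_add)
  then show "\<ominus>\<^bsub>M\<^esub> u \<in> ?L"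
    using u submoduleE(3)[OF K] by blast
  show "d \<odot>\<^bsub>M\<^esub> u \<in> ?L" if d: "d \<in> carrier R" for d
  proof -
    have "d \<odot>\<^bsub>M\<^esub> u = d \<odot>\<^bsub>M\<^esub> k \<oplus>\<^bsub>M\<^esub> (d \<otimes> c) \<odot>\<^bsub>M\<^esub> y"
      using u y Kc d by (simp add: smult_r_distr smult_assoc1)
    then show ?thesis
      using u d submoduleE(4)[OF K] by blast
  qed
  fix v assume "v \<in> ?L"
  then obtain l d where v: "l \<in> K" "d \<in> carrier R" "v = l \<oplus>\<^bsub>M\<^esub> d \<odot>\<^bsub>M\<^esub> y"
    by blast
  have "u \<oplus>\<^bsub>M\<^esub> v = (k \<oplus>\<^bsub>M\<^esub> l) \<oplus>\<^bsub>M\<^esub> (c \<oplus> d) \<odot>\<^bsub>M\<^esub> y"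
    using u v y Kc by (simp add: smult_l_distr M.a_ac)
  then show "u \<oplus>\<^bsub>M\<^esub> v \<in> ?L"
    using u v submoduleE(5)[OF K] by blast
qed

section \<open>Krull's intersection theorem through submodules maximal among those avoiding an
  element\<close>

lemma exists_maximal_submodule_avoiding:
  assumes z: "z \<in> carrier M" "z \<noteq> \<zero>\<^bsub>M\<^esub>"
  obtains K where "submodule K R M" "z \<notin> K"
    "\<And>L. submodule L R M \<Longrightarrow> K \<subseteq> L \<Longrightarrow> z \<notin> L \<Longrightarrow> L = K"
proof -
  let ?S = "{K. submodule K R M \<and> z \<notin> K}"
  have "\<Union>C \<in> ?S" if C: "C \<noteq> {}" "subset.chain ?S C" for C
  proof -
    have sub: "submodule K R M" "z \<notin> K" if "K \<in> C" for K
      using C(2) that unfolding pred_on.chain_def by auto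
    have "submodule (\<Union>C) R M"
    proof (rule submoduleI)
      fix a b assume "a \<in> \<Union>C" "b \<in> \<Union>C"
      then obtain K where "K \<in> C" "a \<in> K" "b \<in> K"
        using C(2) unfolding pred_on.chain_def by blast
      then show "a \<oplus>\<^bsub>M\<^esub> b \<in> \<Union>C"
        using submoduleE(5) sub(1) by blast
    next
      show "\<zero>\<^bsub>M\<^esub> \<in> \<Union>C"
        using C(1) sub(1) submodule_zero_closed by blast
    next
      show "\<Union>C \<subseteq> carrier M"
        using sub(1) submoduleE(1) by blast
    next
      show "\<ominus>\<^bsub>M\<^esub> a \<in> \<Union>C" if "a \<in> \<Union>C" for a
        using that sub(1) submoduleE(3) by blast
    next
      show "c \<odot>\<^bsub>M\<^esub> a \<in> \<Union>C" if "c \<in> carrier R" "a \<in> \<Union>C" for c a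
        using that sub(1) submoduleE(4) by blast
    qed
    then show ?thesis
      using sub(2) by blast
  qed
  moreover have "{\<zero>\<^bsub>M\<^esub>} \<in> ?S"
    using zero_submodule z(2) by simp
  ultimately have "\<exists>K\<in>?S. \<forall>L\<in>?S. K \<subseteq> L \<longrightarrow> L = K"
    by (intro subset_Zorn_nonempty) auto
  then show ?thesis
    using that by auto
qed

text \<open>If \<open>K\<close> does not contain \<open>a z\<close>, then by maximality
  \<open>K + R a z\<close> contains \<open>z\<close>, say \<open>z = k + c a z\<close>. Hence
  \<open>(1 - c a) z = k\<close> lies in \<open>K\<close>, and \<open>1 - c a\<close> is a
  unit.\<close>

lemma maximal_avoiding_smult:
  assumes "local_ring R \<mm>" and z: "z \<in> carrier M"
    and K: "submodule K R M" "z \<notin> K"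
    and max: "\<And>L. submodule L R M \<Longrightarrow> K \<subseteq> L \<Longrightarrow> z \<notin> L \<Longrightarrow> L = K"
    and a: "a \<in> \<mm>"
  shows "a \<odot>\<^bsub>M\<^esub> z \<in> K"
proof (rule ccontr)
  interpret local_ring R \<mm> by (rule assms(1))
  have ac: "a \<in> carrier R"
    using a Icarr by auto
  let ?L = "{k \<oplus>\<^bsub>M\<^esub> c \<odot>\<^bsub>M\<^esub> (a \<odot>\<^bsub>M\<^esub> z) | k c. k \<in> K \<and> c \<in> carrier R}"
  have Kc: "k \<in> carrier M" if "k \<in> K" for k
    using submoduleE(1)[OF K(1)] that by blast
  have L: "submodule ?L R M"
    using submodule_add_cyclic[OF K(1)] ac z by simp
  have "K \<subseteq> ?L"
  proof
    fix k assume "k \<in> K"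
    moreover from this have "k = k \<oplus>\<^bsub>M\<^esub> \<zero> \<odot>\<^bsub>M\<^esub> (a \<odot>\<^bsub>M\<^esub> z)"
      using Kc ac z by simp
    ultimately show "k \<in> ?L" by blast
  qed
  moreover have "a \<odot>\<^bsub>M\<^esub> z = \<zero>\<^bsub>M\<^esub> \<oplus>\<^bsub>M\<^esub> \<one> \<odot>\<^bsub>M\<^esub> (a \<odot>\<^bsub>M\<^esub> z)"
    using ac z by simp
  then have "a \<odot>\<^bsub>M\<^esub> z \<in> ?L"
    using submodule_zero_closed[OF K(1)] by blast
  moreover assume "a \<odot>\<^bsub>M\<^esub> z \<notin> K"
  ultimately have "z \<in> ?L"
    using max[OF L] by blast
  then obtain k c where k: "k \<in> K" "c \<in> carrier R" "z = k \<oplus>\<^bsub>M\<^esub> c \<odot>\<^bsub>M\<^esub> (a \<odot>\<^bsub>M\<^esub> z)"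
    by blast
  let ?u = "\<one> \<ominus> c \<otimes> a"
  have u: "?u \<in> Units R"
    using one_minus_mem_Units[of "c \<otimes> a"] a k(2) I_l_closed by blast
  have "?u \<odot>\<^bsub>M\<^esub> z = z \<oplus>\<^bsub>M\<^esub> \<ominus>\<^bsub>M\<^esub> (c \<odot>\<^bsub>M\<^esub> (a \<odot>\<^bsub>M\<^esub> z))"
    using k(2) ac z unfolding a_minus_def
    by (simp add: smult_l_distr smult_l_minus smult_assoc1)
  also have "\<dots> = k"
    using k ac z Kc by (metis M.add.inv_solve_right smult_closed)
  finally have "inv ?u \<odot>\<^bsub>M\<^esub> (?u \<odot>\<^bsub>M\<^esub> z) \<in> K"
    using k(1) u submoduleE(4)[OF K(1)] by simp
  moreover have "inv ?u \<odot>\<^bsub>M\<^esub> (?u \<odot>\<^bsub>M\<^esub> z) = z"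
    using u z Units_closed[OF u] by (simp flip: smult_assoc1)
  ultimately show False
    using K(2) by simp
qed

text \<open>The conductors \<open>(K : a^n x)\<close> ascend, so two consecutive ones agree. For
  that \<open>n\<close> put \<open>y = a^n x\<close>. If \<open>z = k + c y\<close> with
  \<open>k\<close> in \<open>K\<close>, then \<open>a z \<in> K\<close> gives
  \<open>a c y \<in> K\<close>, hence \<open>c y \<in> K\<close> and \<open>z \<in> K\<close>. So
  \<open>K + R y\<close> avoids \<open>z\<close> and equals \<open>K\<close> by maximality.\<close>

lemma maximal_avoiding_pow_smult:
  assumes "local_ring R \<mm>" and z: "z \<in> carrier M"
    and K: "submodule K R M" "z \<notin> K"
    and max: "\<And>L. submodule L R M \<Longrightarrow> K \<subseteq> L \<Longrightarrow> z \<notin> L \<Longrightarrow> L = K"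
    and a: "a \<in> \<mm>" and x: "x \<in> carrier M"
  shows "\<exists>n::nat. a [^] n \<odot>\<^bsub>M\<^esub> x \<in> K"
proof -
  interpret local_ring R \<mm> by (rule assms(1))
  have ac: "a \<in> carrier R"
    using a Icarr by auto
  have Kc: "k \<in> carrier M" if "k \<in> K" for k
    using submoduleE(1)[OF K(1)] that by blast
  have az: "a \<odot>\<^bsub>M\<^esub> z \<in> K"
    by (rule maximal_avoiding_smult[OF assms(1) z K max a])
  \<comment> \<open>Raising the exponent amounts to multiplying by \<open>a\<close>. This shows that
    the ideals \<open>?I n\<close> ascend, and later turns \<open>a c y \<in> K\<close> into
    \<open>c \<in> ?I (Suc n)\<close>.\<close>
  have suc: "t \<odot>\<^bsub>M\<^esub> (a [^] Suc n \<odot>\<^bsub>M\<^esub> x) = a \<odot>\<^bsub>M\<^esub> (t \<odot>\<^bsub>M\<^esub> (a [^] n \<odot>\<^bsub>M\<^esub> x))"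
    if "t \<in> carrier R" for t and n :: nat
  proof -
    have "t \<otimes> a [^] Suc n = a \<otimes> (t \<otimes> a [^] n)"
      using that ac by (simp add: R.m_ac)
    then show ?thesis
      using that ac x by (simp flip: smult_assoc1 del: nat_pow_Suc)
  qed
  let ?I = "\<lambda>n::nat. {t \<in> carrier R. t \<odot>\<^bsub>M\<^esub> (a [^] n \<odot>\<^bsub>M\<^esub> x) \<in> K}"
  obtain n where n: "?I (Suc n) = ?I n"
  proof (rule ascending_ideals_stabilise[of ?I])
    show "ideal (?I n) R" for n
      using ideal_smult_mem_submodule[OF K(1)] ac x by simp
    show "?I n \<subseteq> ?I (Suc n)" for n
      using suc submoduleE(4)[OF K(1)] ac by auto
  qed blast
  define y where "y = a [^] n \<odot>\<^bsub>M\<^esub> x"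
  have y: "y \<in> carrier M"
    using ac x y_def by simp
  let ?L = "{k \<oplus>\<^bsub>M\<^esub> c \<odot>\<^bsub>M\<^esub> y | k c. k \<in> K \<and> c \<in> carrier R}"
  have L: "submodule ?L R M"
    using submodule_add_cyclic[OF K(1) y] .
  have "K \<subseteq> ?L"
  proof
    fix k assume "k \<in> K"
    moreover from this have "k = k \<oplus>\<^bsub>M\<^esub> \<zero> \<odot>\<^bsub>M\<^esub> y"
      using Kc y by simp
    ultimately show "k \<in> ?L" by blast
  qed
  moreover have "z \<notin> ?L"
  proof
    assume "z \<in> ?L"
    then obtain k c where k: "k \<in> K" "c \<in> carrier R" "z = k \<oplus>\<^bsub>M\<^esub> c \<odot>\<^bsub>M\<^esub> y"
      by blast
    have "a \<odot>\<^bsub>M\<^esub> z = a \<odot>\<^bsub>M\<^esub> k \<oplus>\<^bsub>M\<^esub> a \<odot>\<^bsub>M\<^esub> (c \<odot>\<^bsub>M\<^esub> y)"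
      using k Kc ac y by (simp add: smult_r_distr)
    then have "a \<odot>\<^bsub>M\<^esub> (c \<odot>\<^bsub>M\<^esub> y) = \<ominus>\<^bsub>M\<^esub> (a \<odot>\<^bsub>M\<^esub> k) \<oplus>\<^bsub>M\<^esub> a \<odot>\<^bsub>M\<^esub> z"
      using k Kc ac y by (simp add: M.r_neg1)
    then have "a \<odot>\<^bsub>M\<^esub> (c \<odot>\<^bsub>M\<^esub> y) \<in> K"
      using az k ac submoduleE(3-5)[OF K(1)] by simp
    then have "c \<in> ?I (Suc n)"
      using suc k(2) unfolding y_def by simp
    then have "c \<odot>\<^bsub>M\<^esub> y \<in> K"
      unfolding n y_def by simp
    then show False
      using k K(2) submoduleE(5)[OF K(1)] by simp
  qed
  moreover have "y = \<zero>\<^bsub>M\<^esub> \<oplus>\<^bsub>M\<^esub> \<one> \<odot>\<^bsub>M\<^esub> y"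
    using y by simp
  then have "y \<in> ?L"
    using submodule_zero_closed[OF K(1)] by blast
  ultimately show ?thesis
    using max[OF L] unfolding y_def by blast
qed

text \<open>Membership is assumed for large \<open>n\<close>, the form in which superficiality
  supplies it; as the powers of \<open>\<qq>\<close> decrease, one large exponent yields the
  contradiction.\<close>

theorem krull_intersection:
  assumes "local_ring R \<mm>" "fin_gen_module R M" "ideal \<qq> R" "\<qq> \<subseteq> \<mm>"
    and z: "z \<in> carrier M"
    and zq: "\<forall>\<^sub>F n in sequentially. z \<in> ideal_smult R (\<qq> [^]\<^bsub>ideals_set R\<^esub> n) M"
  shows "z = \<zero>\<^bsub>M\<^esub>"
proof (rule ccontr)
  interpret local_ring R \<mm> by (rule assms(1))
  assume "z \<noteq> \<zero>\<^bsub>M\<^esub>"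
  then obtain K where K: "submodule K R M" "z \<notin> K"
    and max: "\<And>L. submodule L R M \<Longrightarrow> K \<subseteq> L \<Longrightarrow> z \<notin> L \<Longrightarrow> L = K"
    using exists_maximal_submodule_avoiding[OF z] by blast
  obtain U where U: "finite U" "U \<subseteq> carrier M" "gen_submodule R M U = carrier M"
    using assms(2) unfolding fin_gen_module_def by blast
  \<comment> \<open>The conductor \<open>(K : M)\<close>. Once every element of \<open>\<qq>\<close>
    is nilpotent modulo it, \<open>ideal_pow_subset\<close> puts a power of \<open>\<qq>\<close>
    inside it.\<close>
  let ?J = "\<Inter>x\<in>carrier M. {t \<in> carrier R. t \<odot>\<^bsub>M\<^esub> x \<in> K}"
  have J: "ideal ?J R"
    using ideal_smult_mem_submodule[OF K(1)] by (intro i_Intersect) auto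
  have "\<exists>n::nat. a [^] n \<in> ?J" if "a \<in> \<qq>" for a
  proof -
    have am: "a \<in> \<mm>" and ac: "a \<in> carrier R"
      using that assms(4) Icarr by auto
    have "\<forall>x\<in>U. \<exists>n::nat. a [^] n \<odot>\<^bsub>M\<^esub> x \<in> K"
      using maximal_avoiding_pow_smult[OF assms(1) z K max am] U(2) by blast
    then obtain f :: "'c \<Rightarrow> nat" where f: "\<And>x. x \<in> U \<Longrightarrow> a [^] f x \<odot>\<^bsub>M\<^esub> x \<in> K"
      by metis
    \<comment> \<open>The exponents \<open>f x\<close> depend on the generator; their sum over the
      finite set \<open>U\<close> bounds them all.\<close>
    define n where "n = (\<Sum>x\<in>U. f x)"
    have "U \<subseteq> {x \<in> carrier M. a [^] n \<odot>\<^bsub>M\<^esub> x \<in> K}"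
    proof (intro subsetI CollectI conjI)
      fix x assume x: "x \<in> U"
      then show "x \<in> carrier M" using U(2) by blast
      have "f x \<le> n"
        using x U(1) unfolding n_def by (simp add: member_le_sum)
      then have "a [^] n = a [^] (n - f x) \<otimes> a [^] f x"
        using ac by (simp add: R.nat_pow_mult)
      then show "a [^] n \<odot>\<^bsub>M\<^esub> x \<in> K"
        using f[OF x] submoduleE(4)[OF K(1)] \<open>x \<in> carrier M\<close> ac by (simp add: smult_assoc1)
    qed
    then have "gen_submodule R M U \<subseteq> {x \<in> carrier M. a [^] n \<odot>\<^bsub>M\<^esub> x \<in> K}"
      using ac by (intro gen_submodule_minimal submodule_preimage K(1)) simp_all
    then show ?thesis
      using ac unfolding U(3) by (intro exI[of _ n]) auto
  qed
  then obtain n :: nat where n: "\<qq> [^]\<^bsub>ideals_set R\<^esub> n \<subseteq> ?J"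
    using ideal_pow_subset[OF R.is_cring assms(3) J] by blast
  obtain k where "k \<ge> n" "z \<in> ideal_smult R (\<qq> [^]\<^bsub>ideals_set R\<^esub> k) M"
    using zq unfolding eventually_sequentially by (meson nle_le)
  moreover have "ideal_smult R (\<qq> [^]\<^bsub>ideals_set R\<^esub> k) M \<subseteq> K"
    unfolding ideal_smult_def
    using n ideal_pow_antimono[OF assms(3) \<open>k \<ge> n\<close>] by (intro gen_submodule_minimal K(1)) blast
  ultimately show False
    using K(2) by blast
qed

text \<open>
  Among the annihilators of elements not killed by any power of \<open>b\<close>, a maximal one containing the
  annihilator of \<open>x\<close> is an associated prime that avoids \<open>b\<close>.
\<close>

lemma pow_smult_eq_zero_if_Ass:
  assumes "noetherian_ring R" and x: "x \<in> carrier M" and a: "a \<in> carrier R" "a \<odot>\<^bsub>M\<^esub> x = \<zero>\<^bsub>M\<^esub>"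
    and b: "b \<in> carrier R" and Ass: "\<And>P. P \<in> Ass R M \<Longrightarrow> a \<in> P \<Longrightarrow> b \<in> P"
  shows "\<exists>n::nat. b [^] n \<odot>\<^bsub>M\<^esub> x = \<zero>\<^bsub>M\<^esub>"
proof (rule ccontr)
  interpret noetherian_ring R by (rule assms(1))
  let ?ann = "\<lambda>y. {t \<in> carrier R. t \<odot>\<^bsub>M\<^esub> y = \<zero>\<^bsub>M\<^esub>}"
  let ?nt = "\<lambda>y. \<forall>n::nat. b [^] n \<odot>\<^bsub>M\<^esub> y \<noteq> \<zero>\<^bsub>M\<^esub>"
  let ?P = "\<lambda>I. \<exists>y\<in>carrier M. I = ?ann y \<and> ?nt y"
  have id: "ideal (?ann y) R" if "y \<in> carrier M" for y
    using ideal_smult_mem_submodule[OF zero_submodule that] by simp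
  assume "\<nexists>n::nat. b [^] n \<odot>\<^bsub>M\<^esub> x = \<zero>\<^bsub>M\<^esub>"
  then have "?P (?ann x)"
    using x by blast
  then obtain I where "ideal I R" and I: "?ann x \<subseteq> I" "?P I"
    and max: "\<And>K. ideal K R \<Longrightarrow> I \<subseteq> K \<Longrightarrow> ?P K \<Longrightarrow> K = I"
    using exists_maximal_ideal_above[OF id[OF x], of ?P] by blast
  obtain y where y: "y \<in> carrier M" "I = ?ann y" and nt: "?nt y"
    using I(2) by blast
  \<comment> \<open>The annihilator can only grow from \<open>y\<close> to \<open>v y\<close>, and
    maximality forbids strict growth as long as no power of \<open>b\<close> kills
    \<open>v y\<close>.\<close>
  have ann_eq: "?ann (v \<odot>\<^bsub>M\<^esub> y) = ?ann y" if v: "v \<in> carrier R" "?nt (v \<odot>\<^bsub>M\<^esub> y)" for v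
  proof -
    have "t \<odot>\<^bsub>M\<^esub> (v \<odot>\<^bsub>M\<^esub> y) = v \<odot>\<^bsub>M\<^esub> (t \<odot>\<^bsub>M\<^esub> y)" if "t \<in> carrier R" for t
      using that v y(1) by (simp flip: smult_assoc1 add: R.m_comm)
    then have "?ann y \<subseteq> ?ann (v \<odot>\<^bsub>M\<^esub> y)"
      using v(1) by auto
    then show ?thesis
      using max[OF id[of "v \<odot>\<^bsub>M\<^esub> y"]] v y by blast
  qed
  have "primeideal I R"
  proof (rule primeidealI[OF \<open>ideal I R\<close> R.is_cring])
    show "carrier R \<noteq> I"
    proof
      assume "carrier R = I"
      then have "\<one> \<in> ?ann y" using y(2) by blast
      then show False using nt[rule_format, of 0] by simp
    qed
    fix u v assume uv: "u \<in> carrier R" "v \<in> carrier R" "u \<otimes> v \<in> I"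
    \<comment> \<open>If no power of \<open>b\<close> kills \<open>v y\<close>, then
      \<open>u\<close> annihilates \<open>v y\<close> and hence \<open>y\<close>. Otherwise
      \<open>b^n v y = 0\<close>, so \<open>v\<close> annihilates \<open>b^n y\<close>, which no
      power of \<open>b\<close> kills, and hence \<open>v\<close> annihilates
      \<open>y\<close>.\<close>
    show "u \<in> I \<or> v \<in> I"
    proof (cases "?nt (v \<odot>\<^bsub>M\<^esub> y)")
      case True
      have "u \<in> ?ann (v \<odot>\<^bsub>M\<^esub> y)"
        using uv y by (simp add: smult_assoc1)
      then show ?thesis
        using ann_eq[OF uv(2) True] y(2) by simp
    next
      case False
      then obtain n :: nat where n: "b [^] n \<odot>\<^bsub>M\<^esub> (v \<odot>\<^bsub>M\<^esub> y) = \<zero>\<^bsub>M\<^esub>"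
        by blast
      have "?nt (b [^] n \<odot>\<^bsub>M\<^esub> y)"
        using nt b y(1) by (simp flip: smult_assoc1 add: R.nat_pow_mult)
      moreover have "v \<in> ?ann (b [^] n \<odot>\<^bsub>M\<^esub> y)"
        using n b uv(2) y(1) by (simp flip: smult_assoc1 add: R.m_comm)
      ultimately show ?thesis
        using ann_eq[of "b [^] n"] b y(2) by simp
    qed
  qed
  then have "I \<in> Ass R M"
    using y unfolding Ass_def by blast
  moreover have "a \<in> I"
    using I(1) a by blast
  ultimately have "b \<in> I"
    by (rule Ass)
  then show False
    using nt[rule_format, of 1] y b by simp
qed

end

section \<open>Quotient modules and superficial sequences\<close>

lemma submodule_abelian_subgroup:
  assumes "module R M" "submodule N R M"
  shows "abelian_subgroup N M"
proof -
  interpret module R M by (rule assms(1))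
  show ?thesis
    by (intro abelian_subgroupI3 additive_subgroup.intro submodule.axioms(1)[OF assms(2)] M.abelian_group_axioms)
qed

context module
begin

lemma quotient_module_carrier:
  "carrier (quotient_module M N) = (\<lambda>x. N +>\<^bsub>M\<^esub> x) ` carrier M"
  unfolding quotient_module_def A_RCOSETS_def' by auto

lemma quotient_module_zero: "\<zero>\<^bsub>quotient_module M N\<^esub> = N"
  by (simp add: quotient_module_def)

context
  fixes N
  assumes N: "submodule N R M"
begin

interpretation abelian_subgroup N M
  by (rule submodule_abelian_subgroup[OF module_axioms N])

lemma quotient_module_add:
  assumes "x \<in> carrier M" "y \<in> carrier M"
  shows "(N +>\<^bsub>M\<^esub> x) \<oplus>\<^bsub>quotient_module M N\<^esub> (N +>\<^bsub>M\<^esub> y) = N +>\<^bsub>M\<^esub> (x \<oplus>\<^bsub>M\<^esub> y)"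
  using a_rcos_sum[OF assms] by (simp add: quotient_module_def)

lemma quotient_module_smult:
  assumes "c \<in> carrier R" "x \<in> carrier M"
  shows "c \<odot>\<^bsub>quotient_module M N\<^esub> (N +>\<^bsub>M\<^esub> x) = N +>\<^bsub>M\<^esub> (c \<odot>\<^bsub>M\<^esub> x)"
proof -
  \<comment> \<open>Scalar multiplication on the quotient is a union over all representatives
    \<open>u\<close> of the coset; it collapses because each of them gives the same coset.\<close>
  have "N +>\<^bsub>M\<^esub> (c \<odot>\<^bsub>M\<^esub> u) = N +>\<^bsub>M\<^esub> (c \<odot>\<^bsub>M\<^esub> x)" if u: "u \<in> N +>\<^bsub>M\<^esub> x" for u
  proof -
    obtain n where n: "n \<in> N" "u = n \<oplus>\<^bsub>M\<^esub> x"
      using u unfolding a_r_coset_def' by blast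
    have "c \<odot>\<^bsub>M\<^esub> u = c \<odot>\<^bsub>M\<^esub> n \<oplus>\<^bsub>M\<^esub> c \<odot>\<^bsub>M\<^esub> x"
      using n assms by (simp add: smult_r_distr)
    moreover have "c \<odot>\<^bsub>M\<^esub> n \<in> N"
      using assms(1) n(1) submoduleE(4)[OF N] by blast
    ultimately have "c \<odot>\<^bsub>M\<^esub> u \<in> N +>\<^bsub>M\<^esub> (c \<odot>\<^bsub>M\<^esub> x)"
      unfolding a_r_coset_def' by blast
    then show ?thesis
      using a_repr_independence' assms by simp
  qed
  moreover have "x \<in> N +>\<^bsub>M\<^esub> x"
    using a_rcos_self assms(2) .
  ultimately have "(\<Union>u\<in>N +>\<^bsub>M\<^esub> x. N +>\<^bsub>M\<^esub> (c \<odot>\<^bsub>M\<^esub> u)) = N +>\<^bsub>M\<^esub> (c \<odot>\<^bsub>M\<^esub> x)"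
    by blast
  then show ?thesis
    by (simp add: quotient_module_def)
qed

lemma quotient_module_eq_zero_iff:
  assumes "x \<in> carrier M"
  shows "N +>\<^bsub>M\<^esub> x = \<zero>\<^bsub>quotient_module M N\<^esub> \<longleftrightarrow> x \<in> N"
  unfolding quotient_module_zero using a_rcos_self[OF assms] a_rcos_const by blast

lemma quotient_module_module: "module R (quotient_module M N)"
proof (rule moduleI[OF R.is_cring])
  have zero: "\<zero>\<^bsub>quotient_module M N\<^esub> = N +>\<^bsub>M\<^esub> \<zero>\<^bsub>M\<^esub>"
    using quotient_module_eq_zero_iff[of "\<zero>\<^bsub>M\<^esub>"] submodule_zero_closed[OF N] by simp
  show "abelian_group (quotient_module M N)"
  proof (rule abelian_groupI)
    fix V assume "V \<in> carrier (quotient_module M N)"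
    then obtain x where x: "x \<in> carrier M" "V = N +>\<^bsub>M\<^esub> x"
      unfolding quotient_module_carrier by blast
    then have "(N +>\<^bsub>M\<^esub> (\<ominus>\<^bsub>M\<^esub> x)) \<oplus>\<^bsub>quotient_module M N\<^esub> V = \<zero>\<^bsub>quotient_module M N\<^esub>"
      unfolding zero by (simp add: quotient_module_add M.l_neg)
    then show "\<exists>Y\<in>carrier (quotient_module M N). Y \<oplus>\<^bsub>quotient_module M N\<^esub> V = \<zero>\<^bsub>quotient_module M N\<^esub>"
      using x(1) unfolding quotient_module_carrier by blast
  qed (auto simp: zero quotient_module_carrier quotient_module_add M.a_ac)
qed (auto simp: quotient_module_carrier quotient_module_add quotient_module_smult
    smult_l_distr smult_r_distr smult_assoc1)

text \<open>The images of the generators generate: the preimage in \<open>M\<close> of the submodule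
  they span contains \<open>U\<close>, so it is all of \<open>M\<close>.\<close>

lemma quotient_module_fin_gen:
  assumes "fin_gen_module R M"
  shows "fin_gen_module R (quotient_module M N)" (is "fin_gen_module R ?L")
proof -
  interpret L: module R ?L
    by (rule quotient_module_module)
  let ?p = "\<lambda>x. N +>\<^bsub>M\<^esub> x"
  obtain U where U: "finite U" "U \<subseteq> carrier M" "gen_submodule R M U = carrier M"
    using assms unfolding fin_gen_module_def by blast
  have pU: "?p ` U \<subseteq> carrier ?L"
    using U(2) by (auto simp: quotient_module_carrier)
  define K where "K = gen_submodule R ?L (?p ` U)"
  have K: "submodule K R ?L"
    unfolding K_def by (rule L.gen_submodule_submodule[OF pU])
  \<comment> \<open>Negation in the quotient is derived from its addition, so it is reached through
    multiplication by \<open>\<ominus> \<one>\<close>.\<close>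
  have neg: "?p (\<ominus>\<^bsub>M\<^esub> x) = \<ominus>\<^bsub>?L\<^esub> ?p x" if "x \<in> carrier M" for x
    using that quotient_module_smult[of "\<ominus> \<one>" x] L.smult_l_minus[of \<one> "?p x"]
    by (simp add: smult_l_minus quotient_module_carrier)
  have "submodule {x \<in> carrier M. ?p x \<in> K} R M"
  proof (rule submoduleI)
    show "\<zero>\<^bsub>M\<^esub> \<in> {x \<in> carrier M. ?p x \<in> K}"
      using quotient_module_eq_zero_iff[of "\<zero>\<^bsub>M\<^esub>"] submodule_zero_closed[OF N]
        L.submodule_zero_closed[OF K] by simp
  qed (auto simp: neg L.submoduleE[OF K] simp flip: quotient_module_add quotient_module_smult)
  moreover have "U \<subseteq> {x \<in> carrier M. ?p x \<in> K}"
    using U(2) L.gen_submodule_incl unfolding K_def by blast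
  ultimately have "carrier M \<subseteq> {x \<in> carrier M. ?p x \<in> K}"
    using gen_submodule_minimal U(3) by metis
  then have "carrier ?L \<subseteq> K"
    by (auto simp: quotient_module_carrier)
  then have "K = carrier ?L"
    using L.submoduleE(1)[OF K] by blast
  then show ?thesis
    using U(1) pU L.module_axioms unfolding fin_gen_module_def K_def by blast
qed

end

section \<open>Superficial elements and the proof for sequences\<close>

lemma superficial_annihilator_trivial:
  assumes "local_ring R \<mm>" "fin_gen_module R M" "ideal \<qq> R" "\<qq> \<subseteq> \<mm>"
    and sup: "\<forall>\<^sub>F n in sequentially.
      colon_elt M (ideal_smult R (\<qq> [^]\<^bsub>ideals_set R\<^esub> (n + 1)) M) c \<inter> ideal_smult R \<qq> M
        = ideal_smult R (\<qq> [^]\<^bsub>ideals_set R\<^esub> n) M"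
    and y: "y \<in> ideal_smult R \<qq> M" "c \<odot>\<^bsub>M\<^esub> y = \<zero>\<^bsub>M\<^esub>"
  shows "y = \<zero>\<^bsub>M\<^esub>"
proof -
  interpret ideal \<qq> R by (rule assms(3))
  have pow: "submodule (ideal_smult R (\<qq> [^]\<^bsub>ideals_set R\<^esub> (n::nat)) M) R M" for n
    using ideal.Icarr[OF R.ideal_pow_ideal[OF assms(3)]] by (intro ideal_smult_submodule) blast
  have yc: "y \<in> carrier M"
    using y(1) submoduleE(1)[OF ideal_smult_submodule[OF a_subset]] by blast
  have "\<forall>\<^sub>F n in sequentially. y \<in> ideal_smult R (\<qq> [^]\<^bsub>ideals_set R\<^esub> n) M"
    using sup
  proof (rule eventually_mono)
    fix n :: nat
    assume "colon_elt M (ideal_smult R (\<qq> [^]\<^bsub>ideals_set R\<^esub> (n + 1)) M) c \<inter> ideal_smult R \<qq> M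
      = ideal_smult R (\<qq> [^]\<^bsub>ideals_set R\<^esub> n) M"
    \<comment> \<open>Here \<open>c y\<close> is zero, which lies in every submodule.\<close>
    moreover have "y \<in> colon_elt M (ideal_smult R (\<qq> [^]\<^bsub>ideals_set R\<^esub> (n + 1)) M) c"
      using y(2) yc submodule_zero_closed[OF pow[of "n + 1"]] unfolding colon_elt_def by simp
    ultimately show "y \<in> ideal_smult R (\<qq> [^]\<^bsub>ideals_set R\<^esub> n) M"
      using y(1) by blast
  qed
  then show ?thesis
    by (rule krull_intersection[OF assms(1-4) yc])
qed

end

theorem proposition2p3:
  fixes A :: "('a, 'm) ring_scheme"
    and M :: "('a, 'b, 'n) module_scheme"
    and \<mm> \<aa> :: "'a set"
    and as :: "'a list"
  assumes "local_ring A \<mm>"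
    and "module A M"
    and "fin_gen_module A M"
    and "ideal \<aa> A"
    and "set as \<subseteq> \<mm>"
    and "filter_regular_seq A M \<aa> as"
    and "\<exists>S. S \<subseteq> carrier A \<and> Idl\<^bsub>A\<^esub> S = \<aa> \<and>
           (\<forall>b\<in>S. absolutely_superficial_seq A \<mm> M (butlast as @ [b]))"
  shows "weak_seq A M \<aa> as"
  unfolding weak_seq_def
proof (intro allI impI subsetI)
  interpret local_ring A \<mm> by (rule assms(1))
  interpret module A M by (rule assms(2))
  obtain S where S: "S \<subseteq> carrier A" "Idl\<^bsub>A\<^esub> S = \<aa>"
    and sup: "\<And>b. b \<in> S \<Longrightarrow> absolutely_superficial_seq A \<mm> M (butlast as @ [b])"
    using assms(7) by blast
  fix i x
  let ?N = "ideal_smult A (seq_ideal A as i) M"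
  assume i: "i < length as" and "x \<in> colon_elt M ?N (as ! i)"
  then have x: "x \<in> carrier M" "(as ! i) \<odot>\<^bsub>M\<^esub> x \<in> ?N"
    unfolding colon_elt_def by auto
  have asc: "set as \<subseteq> carrier A"
    using assms(5) Icarr by blast
  then have ac: "as ! i \<in> carrier A"
    using i nth_mem by blast
  have "ideal (seq_ideal A as i) A"
    unfolding seq_ideal_def using asc set_take_subset by (intro genideal_ideal) fast
  then have N: "submodule ?N A M"
    by (intro ideal_smult_submodule) (auto dest: ideal.Icarr)
  define L where "L = quotient_module M ?N"
  interpret L: module A L
    unfolding L_def by (rule quotient_module_module[OF N])
  have fgL: "fin_gen_module A L"
    unfolding L_def by (rule quotient_module_fin_gen[OF N assms(3)])
  define y where "y = ?N +>\<^bsub>M\<^esub> x"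
  have y: "y \<in> carrier L"
    using x(1) unfolding y_def L_def quotient_module_carrier by blast
  \<comment> \<open>From here on the colon conditions in \<open>M\<close> are read as annihilation
    of the coset \<open>y\<close> in \<open>L\<close>.\<close>
  have smult_y: "c \<odot>\<^bsub>L\<^esub> y = \<zero>\<^bsub>L\<^esub> \<longleftrightarrow> c \<odot>\<^bsub>M\<^esub> x \<in> ?N" if "c \<in> carrier A" for c
    using that x(1) unfolding y_def L_def
    by (simp add: quotient_module_smult[OF N] quotient_module_eq_zero_iff[OF N])
  have "b \<odot>\<^bsub>M\<^esub> x \<in> ?N" if b: "b \<in> S" for b
  proof -
    let ?bs = "butlast as @ [b]"
    let ?q = "Idl\<^bsub>A\<^esub> (set ?bs)"
    have bc: "b \<in> carrier A"
      using b S(1) by blast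
    \<comment> \<open>Only the last entry is replaced, so for \<open>i < length as\<close> the
      preceding entries, and with them the quotient \<open>L\<close>, are unchanged.\<close>
    have len: "length ?bs = length as" "take i ?bs = take i as"
      using i by (simp_all add: take_butlast)
    have bs: "set ?bs \<subseteq> \<mm>"
      using sup[OF b] unfolding absolutely_superficial_seq_def by blast
    then have bsc: "set ?bs \<subseteq> carrier A"
      using Icarr by blast
    have q: "ideal ?q A" "?q \<subseteq> \<mm>"
      using genideal_ideal[OF bsc] genideal_minimal[OF is_ideal bs] by auto
    have bq: "b \<in> ?q"
      using genideal_self[OF bsc] by auto
    have "seq_quotient A M ?bs i = L"
      unfolding seq_quotient_def seq_ideal_def L_def len ..
    moreover have "\<forall>\<^sub>F n in sequentially.
        colon_elt (seq_quotient A M ?bs i) (ideal_smult A (?q [^]\<^bsub>ideals_set A\<^esub> (n + 1)) (seq_quotient A M ?bs i)) (?bs ! i)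
            \<inter> ideal_smult A ?q (seq_quotient A M ?bs i)
          = ideal_smult A (?q [^]\<^bsub>ideals_set A\<^esub> n) (seq_quotient A M ?bs i)"
      using sup[OF b] i len(1) unfolding absolutely_superficial_seq_def Let_def by presburger
    ultimately have "\<forall>\<^sub>F n in sequentially.
        colon_elt L (ideal_smult A (?q [^]\<^bsub>ideals_set A\<^esub> (n + 1)) L) (?bs ! i) \<inter> ideal_smult A ?q L
          = ideal_smult A (?q [^]\<^bsub>ideals_set A\<^esub> n) L"
      by (rule subst)
    note trivial = L.superficial_annihilator_trivial[OF assms(1) fgL q this]
    have "b \<odot>\<^bsub>L\<^esub> y = \<zero>\<^bsub>L\<^esub>"
    proof (cases "i = length as - 1")
      case False
      then have "i < length as - 1"
        using i by simp
      \<comment> \<open>Before the last position \<open>as ! i\<close> is itself an entry of the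
        superficial sequence, and it kills \<open>b y\<close>, which lies in
        \<open>?q L\<close>.\<close>
      then have "?bs ! i = as ! i"
        by (simp add: nth_append nth_butlast)
      moreover have "(as ! i) \<odot>\<^bsub>L\<^esub> (b \<odot>\<^bsub>L\<^esub> y) = b \<odot>\<^bsub>L\<^esub> ((as ! i) \<odot>\<^bsub>L\<^esub> y)"
        using ac bc y by (simp flip: L.smult_assoc1 add: m_comm)
      ultimately show ?thesis
        using trivial L.smult_mem_ideal_smult[OF bq y] smult_y[OF ac] x(2) bc by simp
    next
      case True
      then have nth: "?bs ! i = b"
        by (simp add: nth_append)
      have "\<exists>n::nat. b [^]\<^bsub>A\<^esub> n \<odot>\<^bsub>L\<^esub> y = \<zero>\<^bsub>L\<^esub>"
      proof (rule L.pow_smult_eq_zero_if_Ass[OF noetherian_ring_axioms y ac _ bc])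
        show "(as ! i) \<odot>\<^bsub>L\<^esub> y = \<zero>\<^bsub>L\<^esub>"
          using smult_y[OF ac] x(2) by simp
        fix P assume "P \<in> Ass A L" "as ! i \<in> P"
        \<comment> \<open>Filter regularity read contrapositively: an associated prime containing
          \<open>as ! i\<close> must lie in the variety of \<open>\<aa>\<close>.\<close>
        then have "\<aa> \<subseteq> P"
          using assms(6) i unfolding filter_regular_seq_def seq_quotient_def L_def prime_variety_def
          by blast
        then show "b \<in> P"
          using genideal_self[OF S(1)] S(2) b by blast
      qed
      then obtain n :: nat where "b [^]\<^bsub>A\<^esub> n \<odot>\<^bsub>L\<^esub> y = \<zero>\<^bsub>L\<^esub>" ..
      then show ?thesis
      proof (induct n)
        case 0
        then show ?case
          using bc y by simp
      next
        case (Suc n)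
        show ?case
        \<comment> \<open>For \<open>n = 0\<close> the hypothesis is already \<open>b y = 0\<close>.
          For positive \<open>n\<close> the element \<open>b^n y\<close> lies in \<open>?q L\<close>
          and is killed by \<open>b\<close>, so it vanishes; \<open>y\<close> itself need not lie in
          \<open>?q L\<close>.\<close>
        proof (cases n)
          case 0
          then show ?thesis using Suc(2) bc by simp
        next
          case (Suc k)
          have "b [^]\<^bsub>A\<^esub> n \<in> ?q"
            using Suc bq bc ideal.I_l_closed[OF q(1)] by simp
          moreover have "b \<odot>\<^bsub>L\<^esub> (b [^]\<^bsub>A\<^esub> n \<odot>\<^bsub>L\<^esub> y) = \<zero>\<^bsub>L\<^esub>"
            using Suc.prems bc y by (simp flip: L.smult_assoc1 add: m_comm)
          ultimately show ?thesis
            using Suc.hyps trivial L.smult_mem_ideal_smult[OF _ y] unfolding nth by blast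
        qed
      qed
    qed
    then show ?thesis
      using smult_y[OF bc] by simp
  qed
  \<comment> \<open>The scalars taking \<open>x\<close> into \<open>?N\<close> form an ideal, so
    checking the generators in \<open>S\<close> was enough.\<close>
  then have "\<aa> \<subseteq> {c \<in> carrier A. c \<odot>\<^bsub>M\<^esub> x \<in> ?N}"
    using S(1) unfolding S(2)[symmetric]
    by (intro genideal_minimal ideal_smult_mem_submodule N x(1)) blast
  then show "x \<in> colon_ideal M ?N \<aa>"
    using x(1) unfolding colon_ideal_def by blast
qed

end
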